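(* Let $p\ge 2$, $N\ge 1$, and let $\mathcal{C}=\{\mathbf{c}_0,\dots,\mathbf{c}_{M-1}\}\subseteq\{0,\dots,p-1\}^N$ be a code with index set $\mathcal{I}=\{0,\dots,M-1\}$. For each $\ell\in\mathcal{I}$, suppose that when $\mathbf{c}_\ell$ is transmitted the output $\mathbf{r}=(r_1,\dots,r_N)\in\{0,\dots,p-1\}^N$ has independent coordinates, with symbol-error probabilities $\epsilon_{\ell,i}=\mathbb{P}(r_i\neq c_{\ell,i}\mid \mathbf{c}_\ell\text{ sent})\in(0,1)$, $i=1,\dots,N$. For an ordered pair $(\ell,\ell')$ with $\ell\neq\ell'$, let $D(\ell,\ell')=\{i: c_{\ell,i}\neq c_{\ell',i}\}$, $d=|D(\ell,\ell')|$, and $d_{\mathrm{wmin}}(\ell,\ell')=\sum_{i\in D(\ell,\ell')}\log(1/\epsilon_{\ell,i})$. Define the events (under transmission of $\mathbf{c}_\ell$) $$\mathcal{A}_{\mathrm{MD}}(\ell'\mid\ell)=\Big\{\#\{i\in D(\ell,\ell'): r_i\neq c_{\ell,i}\}>\Big\lfloor\tfrac{d-1}{2}\Big\rfloor\Big\},$$ $$\mathcal{A}_{\mathrm{wMD}}(\ell'\mid\ell)=\Big\{\textstyle\sum_{i\in D(\ell,\ell')}\log(1/\epsilon_{\ell,i})\,\mathbf{1}_{\{r_i\neq c_{\ell,i}\}}>\tfrac{1}{2}d_{\mathrm{wmin}}(\ell,\ell')\Big\}.$$ Call a pair $(\ell,\ell')$ trivial if there is a codeword $\mathbf{c}_{\ell''}$,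 $\ell''\neq \ell$, with $D(\ell,\ell'')$ a proper subset of $D(\ell,\ell')$; for trivial pairs both error probabilities are set to $0$. Define $$P_{\mathrm{e,MD}}=\frac{1}{|\mathcal{I}|}\sum_{\ell\in\mathcal{I}}\sum_{\ell'\neq\ell,\ (\ell,\ell')\text{ nontrivial}}\mathbb{P}(\mathcal{A}_{\mathrm{MD}}(\ell'\mid\ell)),\qquad P_{\mathrm{e,wMD}}=\frac{1}{|\mathcal{I}|}\sum_{\ell\in\mathcal{I}}\sum_{\ell'\neq\ell,\ (\ell,\ell')\text{ nontrivial}}\mathbb{P}(\mathcal{A}_{\mathrm{wMD}}(\ell'\mid\ell)).$$ Then $P_{\mathrm{e,wMD}}\le P_{\mathrm{e,MD}}$.
   Context: Context: uplink MIMO with $K$ single-antenna users, $m$-ary messages, and $p$-level ADCs at a base station with $N_{\rm r}$ antennas, $N=2N_{\rm r}$. The code $\mathcal{C}$ has $M=m^K$ codewords $\mathbf{c}_\ell=[\phi_p(\mathbf{h}_1^{\mathsf T}\mathbf{x}(g(\ell))),\dots,\phi_p(\mathbf{h}_N^{\mathsf T}\mathbf{x}(g(\ell)))]^{\mathsf T}$, where $\phi_p$ is the ADC quantizer, $\mathbf{h}_i^{\mathsf T}$ the rows of the real channel matrix and $\mathbf{x}(g(\ell))$ the transmitted real symbol vector for message index $\ell$; the received vector is $r_i=\phi_p(\mathbf{h}_i^{\mathsf T}\mathbf{x}+z_i)$ with independent Gaussian noise, giving independent coordinates. Minimum distance decoding (MDD) picks $\arg\min_\ell$ of the Hamming distance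 $d_{\rm h}(\mathbf{r},\mathbf{c}_\ell)$; weighted minimum distance decoding (wMDD) picks $\arg\min_\ell \sum_{i=1}^N \log(1/\epsilon_{\ell,i})\mathbf{1}_{\{r_i\neq c_{\ell,i}\}}$. The events $\mathcal{A}_{\mathrm{MD}}(\ell'|\ell)$, $\mathcal{A}_{\mathrm{wMD}}(\ell'|\ell)$ are the pairwise events that MDD, resp. wMDD, selects $\mathbf{c}_{\ell'}$ over the transmitted $\mathbf{c}_\ell$, as defined in the claim. *)

theory Defs
  imports "HOL-Probability.Probability"
begin

text \<open>Codewords: c l i is the i-th symbol (i in {1..N}) of codeword l (l < M).
  Channel: for each transmitted index l, a probability space Q l and received
  symbols r l i (random variables on Q l).\<close>

definition Dset :: "(nat \<Rightarrow> nat \<Rightarrow> nat) \<Rightarrow> nat \<Rightarrow> nat \<Rightarrow> nat \<Rightarrow> nat set" where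
  "Dset c N l l' = {i \<in> {1..N}. c l i \<noteq> c l' i}"

definition trivial_pair :: "(nat \<Rightarrow> nat \<Rightarrow> nat) \<Rightarrow> nat \<Rightarrow> nat \<Rightarrow> nat \<Rightarrow> nat \<Rightarrow> bool" where
  "trivial_pair c N M l l' \<longleftrightarrow> (\<exists>l''<M. l'' \<noteq> l \<and> Dset c N l l'' \<subset> Dset c N l l')"

definition event_MD :: "(nat \<Rightarrow> 'a measure) \<Rightarrow> (nat \<Rightarrow> nat \<Rightarrow> 'a \<Rightarrow> nat)
    \<Rightarrow> (nat \<Rightarrow> nat \<Rightarrow> nat) \<Rightarrow> nat \<Rightarrow> nat \<Rightarrow> nat \<Rightarrow> 'a set" where
  "event_MD Q r c N l l' =
     {\<omega> \<in> space (Q l).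
        int (card {i \<in> Dset c N l l'. r l i \<omega> \<noteq> c l i})
          > \<lfloor>(real (card (Dset c N l l')) - 1) / 2\<rfloor>}"

definition d_wmin :: "(nat \<Rightarrow> nat \<Rightarrow> real) \<Rightarrow> (nat \<Rightarrow> nat \<Rightarrow> nat) \<Rightarrow> nat \<Rightarrow> nat \<Rightarrow> nat \<Rightarrow> real" where
  "d_wmin eps c N l l' = (\<Sum>i\<in>Dset c N l l'. ln (1 / eps l i))"

definition event_wMD :: "(nat \<Rightarrow> 'a measure) \<Rightarrow> (nat \<Rightarrow> nat \<Rightarrow> 'a \<Rightarrow> nat)
    \<Rightarrow> (nat \<Rightarrow> nat \<Rightarrow> nat) \<Rightarrow> (nat \<Rightarrow> nat \<Rightarrow> real) \<Rightarrow> nat \<Rightarrow> nat \<Rightarrow> nat \<Rightarrow> 'a set" where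
  "event_wMD Q r c eps N l l' =
     {\<omega> \<in> space (Q l).
        (\<Sum>i\<in>Dset c N l l'. ln (1 / eps l i) * (if r l i \<omega> \<noteq> c l i then 1 else 0))
          > d_wmin eps c N l l' / 2}"

definition Pe_MD :: "(nat \<Rightarrow> 'a measure) \<Rightarrow> (nat \<Rightarrow> nat \<Rightarrow> 'a \<Rightarrow> nat)
    \<Rightarrow> (nat \<Rightarrow> nat \<Rightarrow> nat) \<Rightarrow> nat \<Rightarrow> nat \<Rightarrow> real" where
  "Pe_MD Q r c N M = (1 / real M) *
     (\<Sum>l<M. \<Sum>l'\<in>{l'. l' < M \<and> l' \<noteq> l \<and> \<not> trivial_pair c N M l l'}.
        measure (Q l) (event_MD Q r c N l l'))"

definition Pe_wMD :: "(nat \<Rightarrow> 'a measure) \<Rightarrow> (nat \<Rightarrow> nat \<Rightarrow> 'a \<Rightarrow> nat)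
    \<Rightarrow> (nat \<Rightarrow> nat \<Rightarrow> nat) \<Rightarrow> (nat \<Rightarrow> nat \<Rightarrow> real) \<Rightarrow> nat \<Rightarrow> nat \<Rightarrow> real" where
  "Pe_wMD Q r c eps N M = (1 / real M) *
     (\<Sum>l<M. \<Sum>l'\<in>{l'. l' < M \<and> l' \<noteq> l \<and> \<not> trivial_pair c N M l l'}.
        measure (Q l) (event_wMD Q r c eps N l l'))"

end

(* Errors of a pair occur on a random subset E of D, where i lies in E with probability e i, and
   wMD errs iff the product of e over E is below theta = exp (- d_wmin / 2). So replacing the factor
   prod_E e in the probability of E by the constant theta only lowers P(MD errs) - P(wMD errs), and
   it remains to compare the two events under the weights prod_(D - E) (1 - e).
   Under these the correct positions F = D - E form a biased sample with odds q = 1 - e \<le> 1, where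
   heavier positions have larger odds, and the claim becomes
   E sgn(X) \<ge> E sgn(N), with X and N the weighted and the plain signed count of F against D - F.
   This is proved by induction that removes the lightest position, in the manner of the
   Littlewood-Offord inequality. *)
theory Submission
  imports Defs
begin

section \<open>Signed sums of biased samples\<close>

text \<open>Up to the factor \<open>\<Prod>i\<in>D. 1 + q i\<close>, this is the mean sign of a walk
  from \<open>x\<close> with steps \<open>w i\<close> or \<open>- w i\<close> at odds
  \<open>q i\<close> to 1. Without normalisation the recursion has no denominators.\<close>

definition sgn_sum :: "('i \<Rightarrow> real) \<Rightarrow> ('i \<Rightarrow> real) \<Rightarrow> 'i set \<Rightarrow> real \<Rightarrow> real" where
  "sgn_sum q w D x = (\<Sum>F\<in>Pow D. (\<Prod>i\<in>F. q i) * sgn (x + (\<Sum>i\<in>F. w i) - (\<Sum>i\<in>D - F. w i)))"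

lemma sgn_sum_insert:
  assumes "finite D" "i \<notin> D"
  shows "sgn_sum q w (insert i D) x = q i * sgn_sum q w D (x + w i) + sgn_sum q w D (x - w i)"
proof -
  define f where "f F = (\<Prod>i\<in>F. q i) * sgn (x + (\<Sum>i\<in>F. w i) - (\<Sum>j\<in>insert i D - F. w j))" for F
  have "sgn_sum q w (insert i D) x = sum f (Pow D) + sum f (insert i ` Pow D)"
    unfolding sgn_sum_def f_def[symmetric] Pow_insert
    using assms by (intro sum.union_disjoint) auto
  moreover have "sum f (insert i ` Pow D) = (\<Sum>F\<in>Pow D. f (insert i F))"
    using assms(2) by (subst sum.reindex) (auto simp: inj_on_def)
  moreover have "f (insert i F) = q i * ((\<Prod>i\<in>F. q i) * sgn (x + w i + (\<Sum>i\<in>F. w i) - (\<Sum>i\<in>D - F. w i)))"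
    if "F \<in> Pow D" for F
  proof -
    have "finite F" "i \<notin> F" "insert i D - insert i F = D - F"
      using that assms finite_subset[of F D] by auto
    then show ?thesis by (simp add: f_def algebra_simps)
  qed
  moreover have "f F = (\<Prod>i\<in>F. q i) * sgn (x - w i + (\<Sum>i\<in>F. w i) - (\<Sum>i\<in>D - F. w i))"
    if "F \<in> Pow D" for F
  proof -
    have "insert i D - F = insert i (D - F)" "i \<notin> D - F"
      using that assms by auto
    then show ?thesis using assms by (simp add: f_def algebra_simps)
  qed
  ultimately show ?thesis
    by (simp add: sgn_sum_def sum_distrib_left)
qed

lemma sgn_sum_mono:
  assumes "\<And>i. i \<in> D \<Longrightarrow> 0 \<le> q i" "x \<le> y"
  shows "sgn_sum q w D x \<le> sgn_sum q w D y"
  unfolding sgn_sum_def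
proof (intro sum_mono mult_left_mono)
  show "sgn (x + sum w F - sum w (D - F)) \<le> sgn (y + sum w F - sum w (D - F))" for F
    using assms(2) by (auto simp: sgn_real_def)
  show "0 \<le> prod q F" if "F \<in> Pow D" for F
    using that assms(1) by (intro prod_nonneg) auto
qed

section \<open>The Littlewood-Offord type inequality for paired offsets\<close>

text \<open>The offsets \<open>\<plusminus>y\<close> and \<open>\<plusminus>z\<close> record the removed lighter positions, and opposite outcomes of these
  are kept as a pair: the term of \<open>a\<close> alone may violate the inequality, and \<open>a \<le> g * q i ^ z\<close> makes the
  term of \<open>g\<close> compensate it. The shift \<open>c\<close> is arbitrary because a removed weight \<open>u > y\<close> moves the
  offset across \<open>0\<close>; the overshoot \<open>u - y\<close> is then absorbed into \<open>c\<close>.\<close>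

lemma sgn_sum_pair_ge:
  fixes q w :: "'i \<Rightarrow> real" and z :: nat
  assumes "finite D"
    and "\<And>i. i \<in> D \<Longrightarrow> 0 < w i" and "\<And>i. i \<in> D \<Longrightarrow> 0 < q i" and "\<And>i. i \<in> D \<Longrightarrow> q i \<le> 1"
    and "\<And>i j. i \<in> D \<Longrightarrow> j \<in> D \<Longrightarrow> w i \<le> w j \<Longrightarrow> q i \<le> q j"
    and "0 \<le> y" "z = 0 \<Longrightarrow> y = 0" "\<And>i. i \<in> D \<Longrightarrow> y \<le> z * w i"
    and "0 \<le> a" "a \<le> g" "\<And>i. i \<in> D \<Longrightarrow> a \<le> g * q i ^ z"
  shows "2 * a * sgn_sum q (\<lambda>_. 1) D z + 2 * g * sgn_sum q (\<lambda>_. 1) D (- real z)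
    \<le> a * (sgn_sum q w D (y + c) + sgn_sum q w D (y - c))
      + g * (sgn_sum q w D (- y + c) + sgn_sum q w D (- y - c))"
  using assms
\<comment> \<open>With the key \<open>- w i\<close> the inserted position is the lightest, hence
  also one of least odds.\<close>
proof (induction D arbitrary: y z a g c rule: finite_ranking_induct[where f="\<lambda>i. - w i"])
  case empty
  \<comment> \<open>For \<open>z > 0\<close> the signs are at most 1; for \<open>z = 0\<close> also
    \<open>y = 0\<close>, and they cancel.\<close>
  have "(g - a) * (sgn (y + c) + sgn (y - c)) \<le> (g - a) * (2 * sgn (real z))"
    using empty.prems by (intro mult_left_mono) (auto simp: sgn_real_def)
  moreover have "sgn (c - y) = - sgn (y - c)" "sgn (- y - c) = - sgn (y + c)"
    by (auto simp: sgn_real_def)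
  ultimately show ?case
    by (cases "z = 0") (simp_all add: sgn_sum_def algebra_simps)
next
  case (insert i D)
  note IH = insert.IH and prems = insert.prems
  show ?case
  proof (cases "i \<in> D")
    case True
    show ?thesis
      using IH[of y z a g c] prems insert_absorb[OF True] by simp
  next
    case iD: False
    define T where "T = sgn_sum q w D"
    define N where "N = sgn_sum q (\<lambda>_. 1) D"
    define u b where "u = w i" and "b = q i"
    have wle: "u \<le> w j" "b \<le> q j" if "j \<in> D" for j
      using insert.hyps that prems(4)[of i j] by (auto simp: u_def b_def)
    have u: "0 < u" and b: "0 < b" "b \<le> 1"
      using prems by (auto simp: u_def b_def)
    have powle: "b ^ k \<le> q j ^ k" if "j \<in> D" for j k
      using wle(2)[OF that] b by (intro power_mono) auto
    have g: "0 \<le> g" using prems by linarith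
    \<comment> \<open>As \<open>u\<close> and \<open>b\<close> bound weights and odds on
      \<open>D\<close> from below, the conditions need checking only there.\<close>
    have IH': "2 * a' * N z' + 2 * g' * N (- real z')
        \<le> a' * (T (y' + c') + T (y' - c')) + g' * (T (- y' + c') + T (- y' - c'))"
      if "0 \<le> y'" "z' = 0 \<Longrightarrow> y' = 0" "y' \<le> z' * u" "0 \<le> a'" "a' \<le> g' * b ^ z'" "0 \<le> g'"
      for y' a' g' c' and z' :: nat
      unfolding T_def N_def
    proof (rule IH)
      show "y' \<le> z' * w j" if "j \<in> D" for j
        using \<open>y' \<le> z' * u\<close> wle(1)[OF that] by (meson mult_left_mono of_nat_0_le_iff order_trans)
      show "a' \<le> g'"
        using that b by (meson less_imp_le mult_left_le order_trans power_le_one)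
      show "a' \<le> g' * q j ^ z'" if "j \<in> D" for j
        using \<open>a' \<le> g' * b ^ z'\<close> powle[OF that] \<open>0 \<le> g'\<close> by (meson mult_left_mono order_trans)
    qed (use that prems in auto)
    have y: "y \<le> z * u" and a: "a \<le> g * b ^ z"
      using prems by (auto simp: u_def b_def)
    \<comment> \<open>The step of \<open>i\<close> yields an outer pair at distance
      \<open>y + u\<close> with coefficients \<open>a * b\<close> and \<open>g\<close>, and an inner
      pair at distance \<open>\<bar>y - u\<bar>\<close> with \<open>a\<close> and
      \<open>g * b\<close>.\<close>
    have "2 * a * (b * N (real z + 1) + N (real z - 1)) + 2 * g * (b * N (- real z + 1) + N (- real z - 1))
      \<le> a * (b * T (y + c + u) + T (y + c - u) + (b * T (y - c + u) + T (y - c - u)))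
        + g * (b * T (- y + c + u) + T (- y + c - u) + (b * T (- y - c + u) + T (- y - c - u)))"
    proof (cases z)
      case 0
      then have "y = 0" using prems by simp
      \<comment> \<open>Both old offsets are 0, so a single pair \<open>u\<close>,
        \<open>- u\<close> with coefficients \<open>(a + g) * b\<close> and \<open>a + g\<close>
        remains.\<close>
      then show ?thesis
        using 0 IH'[of u 1 "(a + g) * b" "a + g" c] u b g prems(8)
        by (simp add: algebra_simps minus_diff_commute)
    next
      case (Suc k)
      have outer: "2 * (a * b) * N (real z + 1) + 2 * g * N (- real z - 1)
        \<le> a * b * (T (y + c + u) + T (y - c + u)) + g * (T (- y + c - u) + T (- y - c - u))"
      proof -
        have "y + u \<le> real (z + 1) * u" "a * b \<le> g * b ^ (z + 1)"
          using y a b by (auto simp: algebra_simps intro: mult_right_mono)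
        moreover have eq: "- u - (c + y) = - c - (u + y)"
          by simp
        ultimately show ?thesis
          using IH'[of "y + u" "z + 1" "a * b" g c] u b g prems(5,8)
          by (simp add: algebra_simps minus_diff_commute eq)
      qed
      define R where "R = 2 * a * N k + 2 * (g * b) * N (- real k)"
      have gb: "a \<le> g * b * b ^ k" "0 \<le> g * b" "a \<le> g * b"
      proof -
        show *: "a \<le> g * b * b ^ k" using a Suc by (simp add: algebra_simps minus_diff_commute)
        show **: "0 \<le> g * b" using g b by simp
        show "a \<le> g * b"
          using * ** b by (meson less_imp_le mult_left_le order_trans power_le_one)
      qed
      have inner: "R \<le> a * (T (y + c - u) + T (y - c - u)) + g * b * (T (- y + c + u) + T (- y - c + u))"
      proof (cases "u \<le> y")
        case True
        \<comment> \<open>For \<open>k = 0\<close> the induction hypothesis demands offset 0; here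
          \<open>u \<le> y \<le> z * u = u\<close>.\<close>
        moreover have "y = u" if "k = 0"
          using that True y Suc by simp
        ultimately show ?thesis
          using IH'[of "y - u" k a "g * b" c] Suc y gb prems(8)
          by (simp add: R_def algebra_simps minus_diff_commute)
      next
        case False
        \<comment> \<open>Now the smaller coefficient \<open>a\<close> sits at the negative offset
          \<open>- t\<close>, so the induction hypothesis is used at offset 0 with several shifts
          instead.\<close>
        define t where "t = u - y"
        define s where "s = a + g * b"
        define h where "h c' = T c' + T (- c')" for c'
        have h: "R \<le> s * h c'" for c'
          using IH'[of 0 k a "g * b" c'] gb u prems(8)
          by (simp add: R_def s_def h_def algebra_simps minus_diff_commute)
        \<comment> \<open>The weights \<open>a\<close>, \<open>a\<close>, \<open>g * b - a\<close>
          of the three shifts add up to \<open>s\<close>, so their combination of \<open>h\<close>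
          inherits the bound \<open>R\<close>.\<close>
        have "s * R \<le> s * (a * h (t + c) + a * h (t - c) + (g * b - a) * h c)"
          using mult_left_mono[OF h[of "t + c"], of a] mult_left_mono[OF h[of "t - c"], of a]
            mult_left_mono[OF h[of c], of "g * b - a"] gb prems(8)
          by (simp add: s_def algebra_simps minus_diff_commute)
        moreover have "0 \<le> s" using gb prems(8) by (simp add: s_def)
        moreover have "R \<le> a * h (t + c) + a * h (t - c) + (g * b - a) * h c" if "s = 0"
        proof -
          have 0: "a = 0" "g * b = 0"
            using that gb(2,3) prems(8) unfolding s_def by linarith+
          show ?thesis unfolding R_def 0 by simp
        qed
        ultimately have "R \<le> a * h (t + c) + a * h (t - c) + (g * b - a) * h c"
          by (cases "s = 0") (simp_all add: mult_le_cancel_left)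
        \<comment> \<open>Monotonicity in the offset, as \<open>t > 0\<close>; the result regroups
          to the inner pair.\<close>
        also have "\<dots> \<le> a * h (t + c) + a * h (t - c) + (g * b - a) * (T (t + c) + T (t - c))"
        proof -
          have "T c \<le> T (t + c)" "T (- c) \<le> T (t - c)"
            using False prems(2) unfolding T_def t_def
            by (auto intro!: sgn_sum_mono simp: less_imp_le)
          then show ?thesis
            using gb by (intro add_left_mono mult_left_mono) (auto simp: h_def)
        qed
        finally show ?thesis
          by (simp add: h_def t_def algebra_simps minus_diff_commute)
      qed
      show ?thesis
        using outer inner Suc by (simp add: R_def algebra_simps minus_diff_commute)
    qed
    then show ?thesis
      using insert.hyps iD
      by (simp add: sgn_sum_insert T_def N_def u_def b_def)
  qed
qed

text \<open>Nothing is removed yet: with \<open>y = z = c = 0\<close> and \<open>a = g = 1\<close>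
  both sides of the paired inequality are four times these sums.\<close>

lemma sgn_sum_ge:
  fixes q w :: "'i \<Rightarrow> real"
  assumes "finite D"
    and "\<And>i. i \<in> D \<Longrightarrow> 0 < w i" and "\<And>i. i \<in> D \<Longrightarrow> 0 < q i" and "\<And>i. i \<in> D \<Longrightarrow> q i \<le> 1"
    and "\<And>i j. i \<in> D \<Longrightarrow> j \<in> D \<Longrightarrow> w i \<le> w j \<Longrightarrow> q i \<le> q j"
  shows "sgn_sum q (\<lambda>_. 1) D 0 \<le> sgn_sum q w D 0"
  using sgn_sum_pair_ge[of D w q 0 0 1 1 0] assms by simp

section \<open>Weighted against plain majority of errors\<close>

lemma weighted_majority_le:
  fixes e :: "'i \<Rightarrow> real"
  assumes D: "finite D" and e: "\<And>i. i \<in> D \<Longrightarrow> 0 < e i" "\<And>i. i \<in> D \<Longrightarrow> e i < 1"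
  shows "(\<Sum>E\<in>{E \<in> Pow D. (\<Sum>i\<in>D. ln (1 / e i)) / 2 < (\<Sum>i\<in>E. ln (1 / e i))}.
            (\<Prod>i\<in>E. e i) * (\<Prod>i\<in>D - E. 1 - e i))
       \<le> (\<Sum>E\<in>{E \<in> Pow D. card D \<le> 2 * card E}. (\<Prod>i\<in>E. e i) * (\<Prod>i\<in>D - E. 1 - e i))"
proof -
  define w where "w i = ln (1 / e i)" for i
  define q where "q i = 1 - e i" for i
  define \<rho> where "\<rho> E = (\<Prod>i\<in>D - E. q i)" for E
  define \<theta> where "\<theta> = exp (- (sum w D / 2))"
  define X where "X E = sum w (D - E) - sum w E" for E
  define N :: "'i set \<Rightarrow> real" where "N E = real (card (D - E)) - real (card E)" for E
  define maj :: "'i set \<Rightarrow> real" where "maj E = of_bool (card D \<le> 2 * card E)" for E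
  define wmaj :: "'i set \<Rightarrow> real" where "wmaj E = of_bool (sum w D / 2 < sum w E)" for E
  have w_eq: "w i = - ln (e i)" if "i \<in> D" for i
    using e(1)[OF that] by (simp add: w_def ln_div)
  \<comment> \<open>Passes from the wrong positions \<open>E\<close> to the correct ones, over which
    \<open>sgn_sum\<close> runs.\<close>
  have compl: "(\<Sum>E\<in>Pow D. f E) = (\<Sum>F\<in>Pow D. f (D - F))" for f :: "'i set \<Rightarrow> real"
    by (rule sum.reindex_bij_witness[of _ "\<lambda>E. D - E" "\<lambda>E. D - E"]) (auto simp: double_diff)
  have dd: "D - (D - F) = F" if "F \<in> Pow D" for F
    using that by auto
  have sgn_sum_compl: "sgn_sum q v D 0 = (\<Sum>E\<in>Pow D. \<rho> E * sgn (sum v (D - E) - sum v E))" for v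
    by (subst compl) (auto simp: sgn_sum_def \<rho>_def dd intro!: sum.cong)
  have "sgn_sum q (\<lambda>_. 1) D 0 \<le> sgn_sum q w D 0"
    using D e by (intro sgn_sum_ge) (auto simp: w_eq q_def less_imp_le)
  then have nonneg: "0 \<le> (\<Sum>E\<in>Pow D. \<rho> E * (sgn (X E) - sgn (N E)))"
    by (simp add: sgn_sum_compl X_def N_def right_diff_distrib sum_subtractf)
  have "\<theta> / 2 * (\<rho> E * (sgn (X E) - sgn (N E))) \<le> (maj E - wmaj E) * ((\<Prod>i\<in>E. e i) * \<rho> E)"
    if E: "E \<in> Pow D" for E
  proof -
    have "0 \<le> \<rho> E" "0 < \<theta>"
      using e unfolding \<rho>_def \<theta>_def by (auto simp: q_def less_imp_le intro!: prod_nonneg)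
    have fin: "finite E" using E D finite_subset by auto
    have "(\<Prod>i\<in>E. e i) = (\<Prod>i\<in>E. exp (- w i))"
      using E e by (intro prod.cong) (auto simp: w_eq subset_iff)
    then have ex: "(\<Prod>i\<in>E. e i) = exp (- sum w E)"
      using fin by (simp add: exp_sum flip: sum_negf)
    have "sum w D = sum w (D - E) + sum w E" "card D = card (D - E) + card E"
      using E D by (auto simp: sum.subset_diff card_Diff_subset fin card_mono)
    then have w: "wmaj E = of_bool (X E < 0)" and m: "maj E = of_bool (N E \<le> 0)"
      by (auto simp: wmaj_def maj_def X_def N_def)
    \<comment> \<open>Ties count for \<open>maj\<close> but not for \<open>wmaj\<close>, so both
      kinds of tie only help.\<close>
    have "\<theta> * (sgn (X E) - sgn (N E)) \<le> 2 * \<theta> * (maj E - wmaj E)"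
      using \<open>0 < \<theta>\<close> by (auto simp: w m sgn_real_def)
    \<comment> \<open>If \<open>maj E - wmaj E\<close> is 1, then \<open>wmaj E = 0\<close> and the
      exponential is at least \<open>\<theta>\<close>; if it is -1, the exponential is below
      \<open>\<theta>\<close>.\<close>
    also have "\<dots> \<le> 2 * exp (- sum w E) * (maj E - wmaj E)"
      by (auto simp: wmaj_def maj_def \<theta>_def)
    finally show ?thesis
      using mult_left_mono[OF _ \<open>0 \<le> \<rho> E\<close>] unfolding ex by (fastforce simp: algebra_simps)
  qed
  then have "\<theta> / 2 * (\<Sum>E\<in>Pow D. \<rho> E * (sgn (X E) - sgn (N E)))
      \<le> (\<Sum>E\<in>Pow D. (maj E - wmaj E) * ((\<Prod>i\<in>E. e i) * \<rho> E))"
    unfolding sum_distrib_left by (intro sum_mono) auto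
  then have "0 \<le> (\<Sum>E\<in>Pow D. (maj E - wmaj E) * ((\<Prod>i\<in>E. e i) * \<rho> E))"
    using nonneg by (smt (verit) \<theta>_def exp_gt_zero half_gt_zero mult_nonneg_nonneg)
  then have "(\<Sum>E\<in>Pow D. wmaj E * ((\<Prod>i\<in>E. e i) * \<rho> E)) \<le> (\<Sum>E\<in>Pow D. maj E * ((\<Prod>i\<in>E. e i) * \<rho> E))"
    by (simp add: left_diff_distrib sum_subtractf)
  moreover have "(\<Sum>E\<in>Pow D. of_bool (P E) * f E) = sum f {E \<in> Pow D. P E}"
    for P and f :: "'i set \<Rightarrow> real"
  proof -
    have "sum f {E \<in> Pow D. P E} = (\<Sum>E\<in>Pow D. if P E then f E else 0)"
      by (rule sum.inter_filter) (use D in auto)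
    then show ?thesis
      by (auto intro: sum.cong)
  qed
  ultimately show ?thesis
    unfolding wmaj_def maj_def w_def \<rho>_def q_def by simp
qed

section \<open>The law of the error set\<close>

context prob_space
begin

text \<open>The event is a disjoint union over the error sets \<open>E\<close> with
  \<open>P E\<close>, and independence factors the probability of each. Both decoders' events have
  this form.\<close>

lemma prob_error_pattern:
  assumes D: "finite D" and indep: "indep_vars (\<lambda>_. count_space UNIV) r D"
    and e: "\<And>i. i \<in> D \<Longrightarrow> e i = prob {\<omega> \<in> space M. r i \<omega> \<noteq> c i}"
  shows "prob {\<omega> \<in> space M. P {i \<in> D. r i \<omega> \<noteq> c i}}
     = (\<Sum>E\<in>{E \<in> Pow D. P E}. (\<Prod>i\<in>E. e i) * (\<Prod>i\<in>D - E. 1 - e i))"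
proof -
  define A where "A E = {\<omega> \<in> space M. {i \<in> D. r i \<omega> \<noteq> c i} = E}" for E
  have meas [measurable]: "r i \<in> measurable M (count_space UNIV)" if "i \<in> D" for i
    using indep that unfolding indep_vars_def by auto
  have err: "{\<omega> \<in> space M. r i \<omega> \<noteq> c i} \<in> events" if "i \<in> D" for i
    using that by measurable
  \<comment> \<open>For empty \<open>D\<close> the intersection would be \<open>UNIV\<close> instead
    of \<open>space M\<close>.\<close>
  have A: "A E = (\<Inter>i\<in>D. r i -` (if i \<in> E then - {c i} else {c i}) \<inter> space M)"
    if "E \<subseteq> D" "D \<noteq> {}" for E
    using that by (auto simp: A_def split: if_splits)
  have A_events: "A E \<in> events" if "E \<subseteq> D" for E
  proof (cases "D = {}")
    case False
    then show ?thesis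
      unfolding A[OF that False] using D by (intro sets.finite_INT measurable_sets[OF meas]) auto
  qed (auto simp: A_def)
  have prob_A: "prob (A E) = (\<Prod>i\<in>E. e i) * (\<Prod>i\<in>D - E. 1 - e i)" if E: "E \<subseteq> D" for E
  proof (cases "D = {}")
    case True
    then show ?thesis using E by (auto simp: A_def prob_space)
  next
    case False
    have "prob (A E) = (\<Prod>i\<in>D. prob (r i -` (if i \<in> E then - {c i} else {c i}) \<inter> space M))"
      unfolding A[OF E False] using D False by (intro indep_varsD[OF indep]) auto
    also have "\<dots> = (\<Prod>i\<in>D. if i \<in> E then e i else 1 - e i)"
    proof (intro prod.cong refl)
      fix i assume i: "i \<in> D"
      have "r i -` (- {c i}) \<inter> space M = {\<omega> \<in> space M. r i \<omega> \<noteq> c i}"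
        "r i -` {c i} \<inter> space M = space M - {\<omega> \<in> space M. r i \<omega> \<noteq> c i}"
        by auto
      then show "prob (r i -` (if i \<in> E then - {c i} else {c i}) \<inter> space M) = (if i \<in> E then e i else 1 - e i)"
        using e[OF i] prob_compl[OF err[OF i]] by simp
    qed
    also have "\<dots> = (\<Prod>i\<in>E. e i) * (\<Prod>i\<in>D - E. 1 - e i)"
      using prod.If_cases[OF D, of "\<lambda>i. i \<in> E" e "\<lambda>i. 1 - e i"] E
      by (simp add: Int_absorb1 Diff_eq)
    finally show ?thesis .
  qed
  have "{\<omega> \<in> space M. P {i \<in> D. r i \<omega> \<noteq> c i}} = (\<Union>E\<in>{E \<in> Pow D. P E}. A E)"
    by (auto simp: A_def)
  also have "prob \<dots> = (\<Sum>E\<in>{E \<in> Pow D. P E}. prob (A E))"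
    using D A_events by (intro finite_measure_finite_Union) (auto simp: disjoint_family_on_def A_def)
  finally show ?thesis
    using prob_A by simp
qed

end

theorem theorem1:
  fixes p N M :: nat
    and c :: "nat \<Rightarrow> nat \<Rightarrow> nat"
    and Q :: "nat \<Rightarrow> 'a measure"
    and r :: "nat \<Rightarrow> nat \<Rightarrow> 'a \<Rightarrow> nat"
    and eps :: "nat \<Rightarrow> nat \<Rightarrow> real"
  assumes "p \<ge> 2" and "N \<ge> 1"
    and code: "\<And>l i. l < M \<Longrightarrow> i \<in> {1..N} \<Longrightarrow> c l i < p"
    and ps: "\<And>l. l < M \<Longrightarrow> prob_space (Q l)"
    and indep: "\<And>l. l < M \<Longrightarrow> prob_space.indep_vars (Q l) (\<lambda>_. count_space UNIV) (r l) {1..N}"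
    and range: "\<And>l i \<omega>. l < M \<Longrightarrow> i \<in> {1..N} \<Longrightarrow> \<omega> \<in> space (Q l) \<Longrightarrow> r l i \<omega> < p"
    and eps_def: "\<And>l i. l < M \<Longrightarrow> i \<in> {1..N} \<Longrightarrow>
                    eps l i = measure (Q l) {\<omega> \<in> space (Q l). r l i \<omega> \<noteq> c l i}"
    and eps_pos: "\<And>l i. l < M \<Longrightarrow> i \<in> {1..N} \<Longrightarrow> 0 < eps l i"
    and eps_lt1: "\<And>l i. l < M \<Longrightarrow> i \<in> {1..N} \<Longrightarrow> eps l i < 1"
  shows "Pe_wMD Q r c eps N M \<le> Pe_MD Q r c N M"
proof -
  \<comment> \<open>Both error probabilities sum over the same pairs, so a comparison pair by pair
    suffices.\<close>
  have "measure (Q l) (event_wMD Q r c eps N l l') \<le> measure (Q l) (event_MD Q r c N l l')"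
    if l: "l < M" for l l'
  proof -
    interpret prob_space "Q l" by (rule ps[OF l])
    define D where "D = Dset c N l l'"
    have D: "finite D" "D \<subseteq> {1..N}"
      by (auto simp: D_def Dset_def)
    have indD: "indep_vars (\<lambda>_. count_space UNIV) (r l) D"
      using indep[OF l] D(2) by (rule indep_vars_subset)
    have epsD: "eps l i = prob {\<omega> \<in> space (Q l). r l i \<omega> \<noteq> c l i}" "0 < eps l i" "eps l i < 1"
      if "i \<in> D" for i
      using that D(2) eps_def eps_pos eps_lt1 l by auto
    note pattern = prob_error_pattern[OF D(1) indD epsD(1)]
    have "event_wMD Q r c eps N l l' = {\<omega> \<in> space (Q l).
        (\<Sum>i\<in>D. ln (1 / eps l i)) / 2 < (\<Sum>i\<in>{i \<in> D. r l i \<omega> \<noteq> c l i}. ln (1 / eps l i))}"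
    proof -
      have "(\<Sum>i\<in>D. ln (1 / eps l i) * (if r l i \<omega> \<noteq> c l i then 1 else 0))
          = (\<Sum>i\<in>{i \<in> D. r l i \<omega> \<noteq> c l i}. ln (1 / eps l i))" for \<omega>
        unfolding sum.inter_filter[OF D(1)] by (intro sum.cong) auto
      then show ?thesis
        by (simp add: event_wMD_def d_wmin_def D_def)
    qed
    moreover have "event_MD Q r c N l l' = {\<omega> \<in> space (Q l).
        card D \<le> 2 * card {i \<in> D. r l i \<omega> \<noteq> c l i}}"
    proof -
      \<comment> \<open>A tie is an MD error; at \<open>d = 0\<close> the floor is -1, so the
        equivalence persists.\<close>
      have "int n > \<lfloor>(real d - 1) / 2\<rfloor> \<longleftrightarrow> d \<le> 2 * n" for n d :: nat
        by (simp add: floor_less_iff) linarith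
      then show ?thesis
        by (simp add: event_MD_def D_def)
    qed
    ultimately show ?thesis
      using weighted_majority_le[OF D(1) epsD(2,3)]
        pattern[of "\<lambda>E. (\<Sum>i\<in>D. ln (1 / eps l i)) / 2 < (\<Sum>i\<in>E. ln (1 / eps l i))"]
        pattern[of "\<lambda>E. card D \<le> 2 * card E"]
      by simp
  qed
  then show ?thesis
    unfolding Pe_wMD_def Pe_MD_def by (intro mult_left_mono sum_mono) auto
qed

end
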